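(* Let $n$ be a positive integer and let $R$ be a Baer $\ast$-ring of type $I_n$ that satisfies axiom (A2). Then $R$ is almost $\ast$-clean. If, in addition, $R$ is von Neumann regular, then $R$ is $\ast$-clean.
   Context: All rings are associative and unital. A $\ast$-ring is a ring $R$ with a map $\ast:R\to R$ with $(x+y)^\ast=x^\ast+y^\ast$, $(xy)^\ast=y^\ast x^\ast$, $(x^\ast)^\ast=x$. A projection is an element $p$ with $p^\ast=p=p^2$. Projections $p,q$ are equivalent, $p\sim q$, if there is $x\in R$ with $x^\ast x=p$ and $xx^\ast=q$; they are orthogonal if $pq=0$. A Baer $\ast$-ring is a $\ast$-ring in which the right annihilator of every nonempty subset is generated, as a right ideal, by a projection. For $S\subseteq R$, $S'$ denotes the commutant of $S$ in $R$ and $S''=(S')'$. A ring is abelian if all its idempotents are central. A projection $p$ is abelian if the ring $pRp$ is abelian; $p$ is faithful if there is no nonzero central idempotent $e$ with $ep=0$. A Baer $\ast$-ring is finite if $x^\ast x=1$ implies $xx^\ast=1$; it is of type $I$ if it has a faithful abelian projection; it is of type $I_f$ if it is of type $I$ and finite; it is of type $I_n$ ($n$ a positive integer) if it is of type $I_f$ and there are $n$ pairwise equivalent, pairwise orthogonal abelian projections with sum $1$. Axiom (A2) is the conjunction of the following two conditions. (EP): for every $0\neq x\in R$ there is a self-adjoint $y\in\{x^\ast x\}''$ such that $(x^\ast x)y^2$ is a nonzero projection. (UPSR): call $x\in R$ positive if $x=x_1^\ast x_1+\dots+x_m^\ast x_m$ for some $m$ and $x_1,\dots,x_m\in R$; for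 every positive $x$ there is a unique $y\in\{x^\ast x\}''$ such that $y^2=x$ and $y$ is positive. An element of a ring is regular if it is neither a left nor a right zero-divisor. A $\ast$-ring is $\ast$-clean (resp. almost $\ast$-clean) if every element is the sum of a unit (resp. a regular element) and a projection. *)

theory Defs
  imports Main
begin

text \<open>
  Rings are types of sort \<open>{ring, monoid_mult}\<close>: associative unital rings, not necessarily
  commutative. Unlike \<open>ring_1\<close>, this sort does not require \<open>0 \<noteq> 1\<close>.
\<close>

locale star_ring =
  fixes star :: "'a::{ring,monoid_mult} \<Rightarrow> 'a"
  assumes star_add: "star (x + y) = star x + star y"
    and star_mult: "star (x * y) = star y * star x"
    and star_star: "star (star x) = x"

definition projection :: "('a::{ring,monoid_mult} \<Rightarrow> 'a) \<Rightarrow> 'a \<Rightarrow> bool" where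
  "projection star p \<longleftrightarrow> star p = p \<and> p * p = p"

definition proj_equiv :: "('a::{ring,monoid_mult} \<Rightarrow> 'a) \<Rightarrow> 'a \<Rightarrow> 'a \<Rightarrow> bool" where
  "proj_equiv star p q \<longleftrightarrow> (\<exists>x. star x * x = p \<and> x * star x = q)"

definition right_annihilator :: "'a::{ring,monoid_mult} set \<Rightarrow> 'a set" where
  "right_annihilator S = {x. \<forall>s\<in>S. s * x = 0}"

locale baer_star_ring = star_ring +
  assumes baer: "S \<noteq> {} \<Longrightarrow> \<exists>p. projection star p \<and> right_annihilator S = range (\<lambda>x. p * x)"

definition commutant :: "'a::{ring,monoid_mult} set \<Rightarrow> 'a set" where
  "commutant S = {x. \<forall>s\<in>S. x * s = s * x}"

definition bicommutant :: "'a::{ring,monoid_mult} set \<Rightarrow> 'a set" where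
  "bicommutant S = commutant (commutant S)"

definition idempotent :: "'a::{ring,monoid_mult} \<Rightarrow> bool" where
  "idempotent e \<longleftrightarrow> e * e = e"

definition central :: "'a::{ring,monoid_mult} \<Rightarrow> bool" where
  "central e \<longleftrightarrow> (\<forall>x. e * x = x * e)"

definition corner :: "'a::{ring,monoid_mult} \<Rightarrow> 'a set" where
  "corner p = range (\<lambda>x. p * x * p)"

text \<open>
  The argument \<open>A\<close> is the underlying set of a ring with the ambient addition and multiplication,
  possibly with its own identity element, such as a corner \<open>pRp\<close>.
\<close>
definition abelian_on :: "'a::{ring,monoid_mult} set \<Rightarrow> bool" where
  "abelian_on A \<longleftrightarrow> (\<forall>e\<in>A. idempotent e \<longrightarrow> (\<forall>x\<in>A. e * x = x * e))"

definition abelian_projection :: "('a::{ring,monoid_mult} \<Rightarrow> 'a) \<Rightarrow> 'a \<Rightarrow> bool" where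
  "abelian_projection star p \<longleftrightarrow> projection star p \<and> abelian_on (corner p)"

definition faithful :: "'a::{ring,monoid_mult} \<Rightarrow> bool" where
  "faithful p \<longleftrightarrow> \<not> (\<exists>e. e \<noteq> 0 \<and> central e \<and> idempotent e \<and> e * p = 0)"

definition finite_star_ring :: "('a::{ring,monoid_mult} \<Rightarrow> 'a) \<Rightarrow> bool" where
  "finite_star_ring star \<longleftrightarrow> (\<forall>x. star x * x = 1 \<longrightarrow> x * star x = 1)"

definition type_I :: "('a::{ring,monoid_mult} \<Rightarrow> 'a) \<Rightarrow> bool" where
  "type_I star \<longleftrightarrow> (\<exists>p. abelian_projection star p \<and> faithful p)"

definition type_I_fin :: "('a::{ring,monoid_mult} \<Rightarrow> 'a) \<Rightarrow> bool" where
  "type_I_fin star \<longleftrightarrow> type_I star \<and> finite_star_ring star"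

definition type_I_n :: "('a::{ring,monoid_mult} \<Rightarrow> 'a) \<Rightarrow> nat \<Rightarrow> bool" where
  "type_I_n star n \<longleftrightarrow> type_I_fin star \<and>
     (\<exists>p :: nat \<Rightarrow> 'a.
        (\<forall>i<n. abelian_projection star (p i)) \<and>
        (\<forall>i<n. \<forall>j<n. i \<noteq> j \<longrightarrow> proj_equiv star (p i) (p j) \<and> p i * p j = 0) \<and>
        (\<Sum>i<n. p i) = 1)"

definition star_positive :: "('a::{ring,monoid_mult} \<Rightarrow> 'a) \<Rightarrow> 'a \<Rightarrow> bool" where
  "star_positive star x \<longleftrightarrow>
     (\<exists>(m::nat) (f :: nat \<Rightarrow> 'a). x = (\<Sum>i<m. star (f i) * f i))"

definition axiom_EP :: "('a::{ring,monoid_mult} \<Rightarrow> 'a) \<Rightarrow> bool" where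
  "axiom_EP star \<longleftrightarrow>
     (\<forall>x. x \<noteq> 0 \<longrightarrow>
        (\<exists>y. y \<in> bicommutant {star x * x} \<and> star y = y \<and>
             projection star ((star x * x) * y\<^sup>2) \<and> (star x * x) * y\<^sup>2 \<noteq> 0))"

definition axiom_UPSR :: "('a::{ring,monoid_mult} \<Rightarrow> 'a) \<Rightarrow> bool" where
  "axiom_UPSR star \<longleftrightarrow>
     (\<forall>x. star_positive star x \<longrightarrow>
        (\<exists>!y. y \<in> bicommutant {star x * x} \<and> y\<^sup>2 = x \<and> star_positive star y))"

definition axiom_A2 :: "('a::{ring,monoid_mult} \<Rightarrow> 'a) \<Rightarrow> bool" where
  "axiom_A2 star \<longleftrightarrow> axiom_EP star \<and> axiom_UPSR star"

definition invertible_elem :: "'a::{ring,monoid_mult} \<Rightarrow> bool" where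
  "invertible_elem u \<longleftrightarrow> (\<exists>v. u * v = 1 \<and> v * u = 1)"

definition left_zero_divisor :: "'a::{ring,monoid_mult} \<Rightarrow> bool" where
  "left_zero_divisor r \<longleftrightarrow> (\<exists>x. x \<noteq> 0 \<and> r * x = 0)"

definition right_zero_divisor :: "'a::{ring,monoid_mult} \<Rightarrow> bool" where
  "right_zero_divisor r \<longleftrightarrow> (\<exists>x. x \<noteq> 0 \<and> x * r = 0)"

definition regular_elem :: "'a::{ring,monoid_mult} \<Rightarrow> bool" where
  "regular_elem r \<longleftrightarrow> \<not> left_zero_divisor r \<and> \<not> right_zero_divisor r"

definition star_clean :: "('a::{ring,monoid_mult} \<Rightarrow> 'a) \<Rightarrow> bool" where
  "star_clean star \<longleftrightarrow> (\<forall>x. \<exists>u p. invertible_elem u \<and> projection star p \<and> x = u + p)"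

definition almost_star_clean :: "('a::{ring,monoid_mult} \<Rightarrow> 'a) \<Rightarrow> bool" where
  "almost_star_clean star \<longleftrightarrow> (\<forall>x. \<exists>r p. regular_elem r \<and> projection star p \<and> x = r + p)"

definition von_neumann_regular :: "'a::{ring,monoid_mult} itself \<Rightarrow> bool" where
  "von_neumann_regular _ \<longleftrightarrow> (\<forall>x::'a. \<exists>y. x * y * x = x)"

end

theory Submission
  imports Defs
begin

text \<open>
  The ring is an \<open>n \<times> n\<close> matrix ring over the corner \<open>A = e\<^sub>0Re\<^sub>0\<close> of an abelian projection, and
  condition (EP) makes \<open>A\<close> behave like a division ring up to central cutting: every nonzero
  element of \<open>A\<close> becomes invertible on some nonzero central projection
  (\<open>invertible_on_projection_of_abelian_corner\<close>). Over a division ring a matrix is cleaned along its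
  diagonal: split off one diagonal corner after another, and subtract \<open>1\<close> from the Schur complement
  exactly when it is \<open>0\<close>. The resulting projection is diagonal, and the difference is
  invertible. The same works here if the central projection may shrink at each of the \<open>n\<close> steps:
  below every nonzero central projection there is a nonzero central projection \<open>h\<close> such that \<open>hx\<close> is
  a unit of \<open>hR\<close> plus a projection (\<open>clean_over_some_central_projection\<close>).

  These local decompositions are glued over a maximal orthogonal family of such \<open>h\<close>. By maximality
  only \<open>0\<close> is annihilated by the whole family. Annihilators in a Baer \<open>*\<close>-ring glue the local
  projections to one projection \<open>p\<close> (\<open>projection_patching\<close>). The local inverses need not glue, so
  \<open>x - p\<close> is merely regular: what it annihilates is annihilated by each \<open>h\<close>
  (\<open>regular_plus_projection_of_clean_over\<close>). In a von Neumann regular ring regular elements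
  are units, whence the second claim.
\<close>

section \<open>Cutting by central idempotents and inverting in corners\<close>

definition central_projection :: "('a::{ring,monoid_mult} \<Rightarrow> 'a) \<Rightarrow> 'a \<Rightarrow> bool" where
  "central_projection star h \<longleftrightarrow> projection star h \<and> central h"

text \<open>
  Inverses are taken in the ring \<open>eRe\<close> with identity \<open>e\<close>; carrying \<open>e\<close> along makes it possible to
  speak of units of all the corners \<open>hE\<^sub>kRE\<^sub>k\<close> inside one type.
\<close>
definition corner_inverse :: "'a::{ring,monoid_mult} \<Rightarrow> 'a \<Rightarrow> 'a \<Rightarrow> bool" where
  "corner_inverse e u v \<longleftrightarrow>
     e * u = u \<and> u * e = u \<and> e * v = v \<and> v * e = v \<and> u * v = e \<and> v * u = e"

definition clean_over :: "('a::{ring,monoid_mult} \<Rightarrow> 'a) \<Rightarrow> 'a \<Rightarrow> 'a \<Rightarrow> bool" where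
  "clean_over star x h \<longleftrightarrow>
     (\<exists>p v. projection star p \<and> h * p = p \<and> corner_inverse h (h * x - p) v)"

lemma mult_left_assoc: "x * y = z \<Longrightarrow> x * (y * t) = z * (t::'a::semigroup_mult)"
  by (simp add: mult.assoc[symmetric])

lemma central_left_commute:
  fixes h :: "'a::{ring,monoid_mult}"
  assumes "central h"
  shows "x * h = h * x" and "x * (h * y) = h * (x * y)"
proof -
  show c: "x * h = h * x" for x
    using assms by (simp add: central_def)
  show "x * (h * y) = h * (x * y)"
    by (metis c mult.assoc)
qed

text \<open>
  Multiplication by a central idempotent, as an opaque operator: as a rewrite rule,
  \<open>x * (h * y) = h * (x * y)\<close> loops at \<open>x = h\<close>, whereas the rules below terminate and move the
  operator to the outside.
\<close>
definition cut :: "'a::{ring,monoid_mult} \<Rightarrow> 'a \<Rightarrow> 'a" where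
  "cut h x = h * x"

lemma cut_rules:
  fixes h :: "'a::{ring,monoid_mult}"
  assumes "central h" and hh: "h * h = h"
  shows "h * x = cut h x" "x * h = cut h x" "cut h x * y = cut h (x * y)" "x * cut h y = cut h (x * y)"
    "cut h (cut h x) = cut h x" "cut h h = h" "cut h 0 = 0" "cut h (- x) = - cut h x"
    "cut h (x + y) = cut h x + cut h y" "cut h (x - y) = cut h x - cut h y"
  unfolding cut_def
proof -
  show "x * h = h * x" "x * (h * y) = h * (x * y)"
    by (rule central_left_commute[OF assms(1)])+
qed (simp_all add: mult.assoc hh mult_left_assoc[OF hh] distrib_left right_diff_distrib)

lemma corner_inverse_central:
  fixes h :: "'a::{ring,monoid_mult}"
  assumes "corner_inverse e u v" and "central h" and hh: "h * h = h"
  shows "corner_inverse (h * e) (h * u) (h * v)"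
proof -
  note H = cut_rules[OF assms(2) hh]
  show ?thesis
    using assms(1) unfolding corner_inverse_def by (simp add: H)
qed

text \<open>
  Block inversion by the Schur complement. With the four corners of \<open>e + f\<close> as blocks, the matrix is
  \<open>(1 + c U) (u + s) (1 + U b)\<close>; its lower right entry is \<open>s + c U b\<close>, so that \<open>s\<close> is the Schur
  complement of \<open>u\<close>. The stated inverse is \<open>(1 - U b) (U + w) (1 - c U)\<close>.
\<close>
lemma corner_inverse_schur:
  fixes e f :: "'a::{ring,monoid_mult}"
  assumes u: "corner_inverse e u U" and s: "corner_inverse f s w"
    and ef: "e * f = 0" "f * e = 0"
    and b: "e * b = b" "b * f = b" and c: "f * c = c" "c * e = c"
  shows "corner_inverse (e + f) (u + b + c + s + c * U * b)
           (U + U * b * w * c * U - U * b * w - w * c * U + w)"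
proof -
  have U: "e * u = u" "u * e = u" "e * U = U" "U * e = U" "u * U = e" "U * u = e"
    using u by (simp_all add: corner_inverse_def)
  have S: "f * s = s" "s * f = s" "f * w = w" "w * f = w" "s * w = f" "w * s = f"
    using s by (simp_all add: corner_inverse_def)
  have ze: "x * y = 0" if "x * e = x" "f * y = y" for x y
    by (metis that ef(1) mult.assoc mult_zero_left mult_zero_right)
  have zf: "x * y = 0" if "x * f = x" "e * y = y" for x y
    by (metis that ef(2) mult.assoc mult_zero_left mult_zero_right)
  have z: "e * c = 0" "e * s = 0" "e * w = 0" "u * c = 0" "u * s = 0" "u * w = 0"
      "U * c = 0" "U * s = 0" "U * w = 0" "c * c = 0" "c * s = 0" "c * w = 0"
      "u * f = 0" "U * f = 0" "c * f = 0"
    using U S b c ef by (metis ze mult.assoc mult_zero_left mult_zero_right)+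
  have z': "f * u = 0" "f * U = 0" "f * b = 0" "s * u = 0" "s * U = 0" "s * b = 0"
      "w * u = 0" "w * U = 0" "w * b = 0" "b * u = 0" "b * U = 0" "b * b = 0"
      "b * e = 0" "s * e = 0" "w * e = 0"
    using U S b c ef by (metis zf mult.assoc mult_zero_left mult_zero_right)+
  note r = U S b c z z'
  show ?thesis
    unfolding corner_inverse_def
    by (simp add: algebra_simps r r[THEN mult_left_assoc])
qed

section \<open>Invertibility in the corner of an abelian projection\<close>

context star_ring
begin

lemma star_zero [simp]: "star 0 = 0"
  using star_add[of 0 0] by simp

lemma star_minus [simp]: "star (- x) = - star x"
  by (metis add.right_inverse minus_unique star_add star_zero)

lemma star_diff: "star (x - y) = star x - star y"
  by (metis diff_conv_add_uminus star_add star_minus)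

lemma star_one [simp]: "star 1 = 1"
  by (metis mult.left_neutral mult.right_neutral star_mult star_star)

lemma star_sum: "star (sum f A) = (\<Sum>x\<in>A. star (f x))"
  by (induction A rule: infinite_finite_induct) (simp_all add: star_add)

text \<open>
  Condition (EP) turns \<open>a\<^sup>*a\<close> into a projection \<open>f = a\<^sup>*a y\<^sup>2\<close>. As \<open>y\<close> lies in the bicommutant of \<open>a\<^sup>*a\<close>
  and \<open>e\<close> commutes with \<open>a\<^sup>*a\<close>, everything stays in the corner \<open>eRe\<close>, where \<open>b = f y\<^sup>2 a\<^sup>*\<close> satisfies
  \<open>b a = f\<close>. Then \<open>a b\<close> is an idempotent too, and since idempotents of \<open>eRe\<close> are central there, it
  must equal \<open>f\<close>: the left inverse is two-sided.
\<close>
lemma invertible_on_projection_of_abelian_corner: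
  assumes EP: "axiom_EP star" and e: "abelian_projection star e"
    and a: "e * a = a" "a * e = a" "a \<noteq> 0"
  obtains f b where "projection star f" "f \<noteq> 0" "e * f = f" "f * e = f"
    "e * b = b" "b * e = b" "a * b = f" "b * a = f"
proof -
  have se: "star e = e"
    and ab: "\<And>f x. f \<in> corner e \<Longrightarrow> f * f = f \<Longrightarrow> x \<in> corner e \<Longrightarrow> f * x = x * f"
    using e by (auto simp: abelian_projection_def projection_def abelian_on_def idempotent_def)
  have corner: "x \<in> corner e" if "e * x = x" "x * e = x" for x
    unfolding corner_def by (rule range_eqI[of _ _ x]) (simp add: that)
  obtain y where y: "y \<in> bicommutant {star a * a}"
    and f: "projection star ((star a * a) * y\<^sup>2)" "(star a * a) * y\<^sup>2 \<noteq> 0"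
    using EP a(3) unfolding axiom_EP_def by blast
  define f where "f = (star a * a) * y\<^sup>2"
  have sa: "star a * e = star a" "e * star a = star a"
    by (metis a se star_mult)+
  have comm: "e \<in> commutant {star a * a}" "star a * a \<in> commutant {star a * a}"
    by (auto simp: commutant_def a sa mult.assoc mult_left_assoc[OF sa(2)])
  have ye: "y * e = e * y" and ya: "y * (star a * a) = (star a * a) * y"
    using y comm unfolding bicommutant_def by (auto simp: commutant_def[of "commutant _"])
  have y2e: "y\<^sup>2 * e = e * y\<^sup>2" and y2a: "y\<^sup>2 * (star a * a) = star a * a * y\<^sup>2"
    by (metis ye power2_eq_square mult.assoc) (metis ya power2_eq_square mult.assoc)
  have ff: "f * f = f"
    using f(1) by (simp add: f_def projection_def)
  have fe: "e * f = f" "f * e = f"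
    unfolding f_def
    by (simp_all add: mult.assoc y2e mult_left_assoc[OF sa(2)] mult_left_assoc[OF a(2)])
  define b where "b = f * (y\<^sup>2 * star a)"
  have be: "e * b = b" "b * e = b"
    unfolding b_def by (simp_all add: mult.assoc sa mult_left_assoc[OF fe(1)])
  have ba: "b * a = f"
    unfolding b_def by (metis ff f_def mult.assoc y2a)
  have fb: "f * b = b"
    unfolding b_def by (simp add: mult_left_assoc[OF ff])
  define g where "g = a * b"
  have ge: "e * g = g" "g * e = g"
    by (simp_all add: g_def mult.assoc be mult_left_assoc[OF a(1)])
  have gg: "g * g = g"
    unfolding g_def by (metis ba fb mult.assoc)
  have fa: "f * a = a * f"
    by (rule ab[OF corner[OF fe] ff corner[OF a(1,2)]])
  have gb: "g * b = b * g"
    by (rule ab[OF corner[OF ge] gg corner[OF be]])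
  have "g = f * g"
    unfolding g_def by (metis fa fb mult.assoc)
  also have "f * g = g * f"
    by (rule ab[OF corner[OF fe] ff corner[OF ge]])
  also have "g * f = f"
    using gb by (metis ba ff g_def mult.assoc)
  finally have "a * b = f" unfolding g_def .
  with that[of f b] f fe be ba show thesis
    by (simp add: f_def)
qed

end

section \<open>Matrix units and central projections\<close>

text \<open>
  The decomposition of \<open>1\<close> that type \<open>I\<^sub>n\<close> provides.
\<close>
locale homogeneous_star_ring = star_ring star for star :: "'a::{ring,monoid_mult} \<Rightarrow> 'a" +
  fixes n :: nat and e :: "nat \<Rightarrow> 'a"
  assumes ab: "i < n \<Longrightarrow> abelian_projection star (e i)"
    and eqv: "i < n \<Longrightarrow> j < n \<Longrightarrow> i \<noteq> j \<Longrightarrow> proj_equiv star (e i) (e j)"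
    and orth: "i < n \<Longrightarrow> j < n \<Longrightarrow> i \<noteq> j \<Longrightarrow> e i * e j = 0"
    and sum_one: "(\<Sum>i<n. e i) = 1"
begin

lemma star_e: "i < n \<Longrightarrow> star (e i) = e i" and idem_e: "i < n \<Longrightarrow> e i * e i = e i"
  using ab by (auto simp: abelian_projection_def projection_def)

text \<open>
  A partial isometry \<open>x\<close> witnessing \<open>e\<^sub>i \<sim> e\<^sub>j\<close> becomes a matrix unit after compression to \<open>e\<^sub>jxe\<^sub>i\<close>.
  The choice \<open>w\<^sub>i = e\<^sub>i\<close> makes the \<open>i\<close>-th diagonal entry below equal to the given one.
\<close>
lemma matrix_unit_column:
  assumes i: "i < n"
  obtains w where "w i = e i"
    "\<And>j. j < n \<Longrightarrow> star (w j) * w j = e i"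
    "\<And>j. j < n \<Longrightarrow> w j * star (w j) = e j"
    "\<And>j. j < n \<Longrightarrow> e j * w j = w j"
    "\<And>j. j < n \<Longrightarrow> w j * e i = w j"
proof -
  have "\<exists>w. (j = i \<longrightarrow> w = e i) \<and> star w * w = e i \<and> w * star w = e j
          \<and> e j * w = w \<and> w * e i = w" if j: "j < n" for j
  proof (cases "j = i")
    case True
    then show ?thesis using i by (auto simp: star_e idem_e)
  next
    case False
    then obtain x where x: "star x * x = e i" "x * star x = e j"
      using eqv[OF i j] by (auto simp: proj_equiv_def)
    note r = idem_e[OF i] idem_e[OF j] x
    have 1: "x * (e i * star x) = e j" "star x * (e j * x) = e i"
      by (metis r mult.assoc)+
    show ?thesis
      using False
      by (intro exI[of _ "e j * x * e i"])
        (simp add: star_mult star_e i j mult.assoc r 1 r[THEN mult_left_assoc]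
          1[THEN mult_left_assoc, unfolded mult.assoc])
  qed
  then obtain w where "\<And>j. j < n \<Longrightarrow> (j = i \<longrightarrow> w j = e i) \<and> star (w j) * w j = e i
      \<and> w j * star (w j) = e j \<and> e j * w j = w j \<and> w j * e i = w j"
    by metis
  with that[of w] i show thesis by blast
qed

text \<open>
  Every projection \<open>f\<close> of the abelian corner \<open>e\<^sub>iRe\<^sub>i\<close> is central there, so the scalar matrix
  \<open>h = \<Sum>\<^sub>j w\<^sub>jfw\<^sub>j\<^sup>*\<close> with \<open>f\<close> on the diagonal is central in the whole ring. The last conclusion
  makes \<open>h\<close> the least central projection above \<open>f\<close>, so that it stays below a given \<open>g\<close>.
\<close>
lemma central_projection_extending:
  assumes i: "i < n" and f: "projection star f" "e i * f = f" "f * e i = f"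
  obtains h where "central_projection star h" "h * e i = f"
    "\<And>g. central g \<Longrightarrow> g * f = f \<Longrightarrow> g * h = h"
proof -
  obtain w where wi: "w i = e i"
    and ww: "\<And>j. j < n \<Longrightarrow> star (w j) * w j = e i" "\<And>j. j < n \<Longrightarrow> w j * star (w j) = e j"
    and ew: "\<And>j. j < n \<Longrightarrow> e j * w j = w j" and we: "\<And>j. j < n \<Longrightarrow> w j * e i = w j"
    using matrix_unit_column[OF i] by blast
  have we': "star (w j) * e j = star (w j)" "e i * star (w j) = star (w j)" if "j < n" for j
    using ew[OF that] we[OF that] star_mult star_e i that by metis+
  have sf: "star f = f" and ff: "f * f = f"
    using f(1) by (simp_all add: projection_def)
  define h where "h = (\<Sum>j<n. w j * f * star (w j))"
  have comm: "f * (star (w j) * r * w k) = (star (w j) * r * w k) * f" if "j < n" "k < n" for j k r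
  proof -
    have "f \<in> corner (e i)"
      unfolding corner_def by (rule range_eqI[of _ _ f]) (simp add: f)
    moreover have "star (w j) * r * w k \<in> corner (e i)"
      unfolding corner_def
      by (rule range_eqI[of _ _ "star (w j) * r * w k"])
        (simp add: mult.assoc we that mult_left_assoc[OF we'(2)])
    ultimately show ?thesis
      using ab[OF i] ff by (auto simp: abelian_projection_def abelian_on_def idempotent_def)
  qed
  have cen: "h * r = r * h" for r
  proof -
    have "h * r = h * r * (\<Sum>k<n. e k)"
      by (simp add: sum_one)
    also have "\<dots> = (\<Sum>j<n. \<Sum>k<n. w j * f * star (w j) * r * (w k * star (w k)))"
      unfolding h_def sum_distrib_right unfolding sum_distrib_left by (simp add: ww)
    also have "\<dots> = (\<Sum>j<n. \<Sum>k<n. w j * (f * (star (w j) * r * w k)) * star (w k))"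
      by (simp add: mult.assoc)
    \<comment> \<open>the entry \<open>w\<^sub>j\<^sup>*rw\<^sub>k\<close> lies in \<open>e\<^sub>iRe\<^sub>i\<close>, where \<open>f\<close> is central\<close>
    also have "\<dots> = (\<Sum>j<n. \<Sum>k<n. w j * ((star (w j) * r * w k) * f) * star (w k))"
      by (simp add: comm)
    also have "\<dots> = (\<Sum>j<n. \<Sum>k<n. w j * star (w j) * (r * (w k * f * star (w k))))"
      by (simp add: mult.assoc)
    also have "\<dots> = (\<Sum>j<n. e j) * (r * h)"
      unfolding h_def sum_distrib_left unfolding sum_distrib_right
      by (simp add: ww) (rule sum.swap)
    finally show ?thesis by (simp add: sum_one)
  qed
  have he: "h * e i = f"
  proof -
    have "w j * f * star (w j) * e i = (if j = i then f else 0)" if "j < n" for j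
    proof (cases "j = i")
      case True
      then show ?thesis using i by (simp add: wi star_e f idem_e mult.assoc)
    next
      case False
      have "star (w j) * e i = star (w j) * (e j * e i)"
        by (simp add: mult.assoc[symmetric] we' that)
      with orth[OF that i False] False show ?thesis by (simp add: mult.assoc)
    qed
    then have "h * e i = (\<Sum>j<n. if j = i then f else 0)"
      unfolding h_def sum_distrib_right by (intro sum.cong) auto
    also have "\<dots> = f" using i by simp
    finally show ?thesis .
  qed
  have upward: "g * h = h" if "central g" "g * f = f" for g
  proof -
    have "g * (w j * (f * star (w j))) = w j * (f * star (w j))" for j
      by (metis central_left_commute[OF that(1)] that(2) mult.assoc)
    then show ?thesis
      by (simp add: h_def sum_distrib_left mult.assoc)
  qed
  have ch: "central h" using cen by (simp add: central_def)
  have "h * f = f" by (metis he f(2) ff mult.assoc)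
  then have "h * h = h" by (rule upward[OF ch])
  moreover have "star h = h"
    by (simp add: h_def star_sum star_mult star_star sf mult.assoc)
  ultimately show thesis
    using that[of h] ch he upward by (simp add: central_projection_def projection_def)
qed

section \<open>Local cleanness along the diagonal\<close>

text \<open>
  If \<open>a\<close> vanishes on \<open>g\<close>, subtract the identity \<open>ge\<^sub>i\<close> of the corner and keep \<open>g\<close>;
  otherwise \<open>ga\<close> is invertible on a smaller central projection and nothing is subtracted.
\<close>
lemma diagonal_entry_clean:
  assumes EP: "axiom_EP star" and i: "i < n" and a: "e i * a = a" "a * e i = a"
    and g: "central_projection star g" "g \<noteq> 0"
  obtains h f w where "central_projection star h" "h \<noteq> 0" "g * h = h"
    "projection star f" "h * f = f" "e i * f = f" "f * e i = f"
    "corner_inverse (h * e i) (h * a - f) w"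
proof -
  have cg: "central g" and gg: "g * g = g" and sg: "star g = g"
    using g(1) by (auto simp: central_projection_def projection_def)
  note c = central_left_commute[OF cg]
  note G = cut_rules[OF cg gg]
  show thesis
  proof (cases "g * a = 0")
    case True
    show thesis
    proof (rule that[of g "g * e i" "- (g * e i)"])
      show "projection star (g * e i)"
        using sg by (simp add: projection_def star_mult star_e[OF i]) (simp add: G idem_e[OF i])
      show "corner_inverse (g * e i) (g * a - g * e i) (- (g * e i))"
        using True by (simp add: corner_inverse_def G idem_e[OF i])
    qed (use g i in \<open>simp_all add: G idem_e\<close>)
  next
    case False
    have ga: "e i * (g * a) = g * a" "g * a * e i = g * a"
      by (simp_all add: G a)
    obtain f b where f: "projection star f" "f \<noteq> 0" "e i * f = f" "f * e i = f"
      and b: "e i * b = b" "b * e i = b" "g * a * b = f" "b * (g * a) = f"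
      using invertible_on_projection_of_abelian_corner[OF EP ab[OF i] ga False] by blast
    obtain h where h: "central_projection star h" "h * e i = f"
      and up: "\<And>g. central g \<Longrightarrow> g * f = f \<Longrightarrow> g * h = h"
      using central_projection_extending[OF i f(1,3,4)] by blast
    have gh: "g * h = h"
      by (rule up[OF cg]) (metis b(3) gg mult.assoc)
    have ch: "central h" and hh: "h * h = h"
      using h(1) by (auto simp: central_projection_def projection_def)
    note H = cut_rules[OF ch hh]
    have hab: "h * (a * b) = f" "h * (b * a) = f"
    proof -
      have hf: "h * f = f" by (metis h(2) hh mult.assoc)
      have "h * (a * b) = h * (g * a * b)" by (metis gh mult.assoc c(1))
      then show "h * (a * b) = f" using b hf by simp
      have "h * (b * a) = h * (b * (g * a))" by (metis gh mult.assoc c)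
      then show "h * (b * a) = f" using b hf by simp
    qed
    show thesis
    proof (rule that[of h 0 "h * b"])
      show "h \<noteq> 0" using f(2) h(2) by auto
      show "corner_inverse (h * e i) (h * a - 0) (h * b)"
        using hab h(2)[symmetric] by (simp add: corner_inverse_def H a b)
    qed (use h gh in \<open>simp_all add: projection_def\<close>)
  qed
qed

text \<open>
  Induction on the size of the leading corner. The new diagonal entry to be cleaned is the Schur
  complement \<open>d = qxq - qxvxq\<close> of the block already made invertible, not \<open>qxq\<close> itself. Cleaning \<open>d\<close>
  shrinks the central projection from \<open>h\<close> to \<open>h'\<close>, and the earlier data survive multiplication by
  \<open>h'\<close>. The old and new projections live in the orthogonal corners \<open>F\<close> and \<open>q\<close>, so
  their sum is again a projection.
\<close>
lemma leading_corner_clean: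
  assumes EP: "axiom_EP star" and g: "central_projection star g" "g \<noteq> 0"
  defines "E \<equiv> \<lambda>k. \<Sum>i<k. e i"
  assumes "k \<le> n"
  shows "\<exists>h p v. central_projection star h \<and> h \<noteq> 0 \<and> g * h = h \<and>
           projection star p \<and> h * p = p \<and> E k * p = p \<and> p * E k = p \<and>
           corner_inverse (h * E k) (h * (E k * x * E k) - p) v"
  using \<open>k \<le> n\<close>
proof (induction k)
  case 0
  show ?case
    by (rule exI[of _ g], rule exI[of _ 0], rule exI[of _ 0])
      (use g in \<open>simp add: E_def corner_inverse_def projection_def central_projection_def\<close>)
next
  case (Suc k)
  then have k: "k < n" by simp
  obtain h p v where h: "central_projection star h" "h \<noteq> 0" "g * h = h"
    and p: "projection star p" "h * p = p" "E k * p = p" "p * E k = p"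
    and v: "corner_inverse (h * E k) (h * (E k * x * E k) - p) v"
    using Suc by auto
  define F where "F = E k"
  define q where "q = e k"
  define d where "d = q * x * q - q * x * v * x * q"
  have qq: "q * q = q" using idem_e[OF k] by (simp add: q_def)
  have FF: "F * F = F"
  proof -
    have "e i * F = e i" if "i < k" for i
    proof -
      have "e i * F = (\<Sum>j<k. if j = i then e i else 0)"
        unfolding F_def E_def sum_distrib_left
        using that k by (intro sum.cong) (auto simp: idem_e orth)
      then show ?thesis using that by simp
    qed
    then show ?thesis
      unfolding F_def E_def by (simp add: sum_distrib_right)
  qed
  have Fq: "F * q = 0" "q * F = 0"
    using k by (simp_all add: F_def E_def q_def sum_distrib_left sum_distrib_right orth)
  have dq: "q * d = d" "d * q = d"
    by (simp_all add: d_def algebra_simps qq mult_left_assoc[OF qq])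
  obtain h' f w where h': "central_projection star h'" "h' \<noteq> 0" "h * h' = h'"
    and f: "projection star f" "h' * f = f" "q * f = f" "f * q = f"
    and w: "corner_inverse (h' * q) (h' * d - f) w"
    using diagonal_entry_clean[OF EP k dq[unfolded q_def] h(1,2)] unfolding q_def by blast
  have ch': "central h'" and hh: "h' * h' = h'" and sh: "star h' = h'"
    using h'(1) by (auto simp: central_projection_def projection_def)
  have ch: "central h" and h0: "h * h = h"
    using h(1) by (auto simp: central_projection_def projection_def)
  note H = cut_rules[OF ch' hh]
  have h'h: "h' * h = h'" using h'(3) central_left_commute(1)[OF ch'] by simp
  have Hf: "cut h' f = f" using f(2) by (simp add: H)
  have hv: "h * v = v"
    using v h0 unfolding corner_inverse_def by (metis mult.assoc)
  have Fv: "F * v = v" "v * F = v"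
  proof -
    have 1: "h * (F * v) = v" "v * (h * F) = v"
      using v unfolding corner_inverse_def F_def by (auto simp: mult.assoc)
    show "F * v = v" using 1(1) FF
      by (metis central_left_commute(2)[OF ch] mult.assoc)
    show "v * F = v" using 1(2) FF
      by (metis mult.assoc)
  qed
  have u: "corner_inverse (h' * F) (h' * (F * x * F) - h' * p) (h' * v)"
    using corner_inverse_central[OF v ch' hh] h'h
    by (simp add: F_def right_diff_distrib mult.assoc[symmetric])
  let ?p = "h' * p + f"
  have schur: "corner_inverse (h' * F + h' * q)
      (h' * (F * x * F) - h' * p + h' * (F * x * q) + h' * (q * x * F) + (h' * d - f)
         + h' * (q * x * F) * (h' * v) * (h' * (F * x * q)))
      (h' * v + h' * v * (h' * (F * x * q)) * w * (h' * (q * x * F)) * (h' * v)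
         - h' * v * (h' * (F * x * q)) * w - w * (h' * (q * x * F)) * (h' * v) + w)"
    by (rule corner_inverse_schur[OF u w])
      (simp_all add: H mult.assoc Fq FF qq mult_left_assoc[OF FF] mult_left_assoc[OF qq])
  have ES: "E (Suc k) = F + q"
    by (simp add: E_def F_def q_def)
  have M: "h' * (F * x * F) - h' * p + h' * (F * x * q) + h' * (q * x * F) + (h' * d - f)
         + h' * (q * x * F) * (h' * v) * (h' * (F * x * q))
       = h' * (E (Suc k) * x * E (Suc k)) - ?p"
    by (simp add: ES d_def H algebra_simps Fv mult_left_assoc[OF Fv(1)] mult_left_assoc[OF Fv(2)])
  have pF: "F * p = p" "p * F = p" using p by (simp_all add: F_def)
  have pp: "p * p = p" "star p = p" and ff: "f * f = f" "star f = f"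
    using p(1) f(1) by (simp_all add: projection_def)
  have pf: "p * f = 0" "f * p = 0" "q * p = 0" "p * q = 0" "F * f = 0" "f * F = 0"
    by (metis Fq pF f(3,4) mult.assoc mult_zero_left mult_zero_right)+
  have "projection star ?p"
  proof -
    have "star (h' * p) = h' * p"
      by (metis star_mult sh pp(2) central_left_commute(1)[OF ch'])
    then show ?thesis
      by (simp add: projection_def star_add ff) (simp add: algebra_simps H Hf pp ff pf)
  qed
  moreover have "h' * ?p = ?p" "E (Suc k) * ?p = ?p" "?p * E (Suc k) = ?p"
    by (simp_all add: ES algebra_simps H Hf f pF pf)
  moreover have "g * h' = h'" by (metis h'(3) h(3) mult.assoc)
  ultimately show ?case
    using h' schur[unfolded M] unfolding ES distrib_left[symmetric] by blast
qed

lemma clean_over_some_central_projection: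
  assumes "axiom_EP star" and "central_projection star g" "g \<noteq> 0"
  obtains h where "central_projection star h" "h \<noteq> 0" "g * h = h" "clean_over star x h"
  using leading_corner_clean[OF assms, of n x] that
  by (auto simp: sum_one clean_over_def)

end

section \<open>Gluing over orthogonal central projections\<close>

context baer_star_ring
begin

text \<open>
  The right annihilator of central elements is a two-sided ideal. Hence the projection \<open>g\<close> generating
  it satisfies \<open>g r g = r g\<close> for all \<open>r\<close>, and taking adjoints \<open>g r g = g r\<close>, so \<open>g\<close> is central.
\<close>
lemma central_projection_annihilator:
  assumes "\<forall>h\<in>H. central h"
  obtains g where "central_projection star g" "\<And>z. (\<forall>h\<in>H. h * z = 0) \<longleftrightarrow> g * z = z"
proof -
  \<comment> \<open>inserting \<open>0\<close> leaves the annihilator unchanged and covers \<open>H = {}\<close>\<close>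
  obtain g where g: "projection star g" "right_annihilator (insert 0 H) = range (\<lambda>x. g * x)"
    using baer[of "insert 0 H"] by blast
  have sg: "star g = g" and gg: "g * g = g"
    using g(1) by (simp_all add: projection_def)
  have iff: "(\<forall>h\<in>H. h * z = 0) \<longleftrightarrow> g * z = z" for z
  proof -
    have "(\<forall>h\<in>H. h * z = 0) \<longleftrightarrow> z \<in> range (\<lambda>x. g * x)"
      by (simp add: g(2)[symmetric] right_annihilator_def)
    also have "\<dots> \<longleftrightarrow> g * z = z"
      by (metis gg mult.assoc rangeE rangeI)
    finally show ?thesis .
  qed
  have grg: "g * (r * g) = r * g" for r
  proof -
    have "h * (r * g) = 0" if "h \<in> H" for h
    proof -
      have "h * g = 0" using iff[of g] gg that by blast
      then show ?thesis
        using central_left_commute(2)[of h r g] assms that by simp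
    qed
    then show ?thesis using iff by blast
  qed
  have "g * r = r * g" for r
  proof -
    have "star (g * (star r * g)) = star (star r * g)" by (simp only: grg)
    then have "g * r * g = g * r" by (simp add: star_mult star_star sg)
    then show ?thesis using grg[of r] by (simp add: mult.assoc)
  qed
  then show thesis
    using that[of g] g(1) iff by (auto simp: central_projection_def central_def)
qed

text \<open>
  The glued projection is \<open>1 - q\<close>, where \<open>q\<close> generates the common annihilator of all the \<open>P h\<close>. By
  orthogonality \<open>h - P h\<close> is annihilated by every \<open>P k\<close>, so \<open>q\<close> fixes it; as \<open>q\<close> kills \<open>P h\<close>, this
  gives \<open>qh = h - P h\<close>.
\<close>
lemma projection_patching:
  assumes cen: "\<And>h. h \<in> H \<Longrightarrow> central_projection star h"
    and orth: "\<And>h k. h \<in> H \<Longrightarrow> k \<in> H \<Longrightarrow> h \<noteq> k \<Longrightarrow> h * k = 0"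
    and P: "\<And>h. h \<in> H \<Longrightarrow> projection star (P h)" "\<And>h. h \<in> H \<Longrightarrow> h * P h = P h"
  obtains p where "projection star p" "\<And>h. h \<in> H \<Longrightarrow> h * p = P h"
proof -
  obtain q where q: "projection star q" "right_annihilator (insert 0 (P ` H)) = range (\<lambda>x. q * x)"
    using baer[of "insert 0 (P ` H)"] by blast
  have sq: "star q = q" and qq: "q * q = q"
    using q(1) by (simp_all add: projection_def)
  have iff: "(\<forall>h\<in>H. P h * z = 0) \<longleftrightarrow> q * z = z" for z
  proof -
    have "(\<forall>h\<in>H. P h * z = 0) \<longleftrightarrow> z \<in> range (\<lambda>x. q * x)"
      by (simp add: q(2)[symmetric] right_annihilator_def)
    also have "\<dots> \<longleftrightarrow> q * z = z"
      by (metis qq mult.assoc rangeE rangeI)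
    finally show ?thesis .
  qed
  have "h * (1 - q) = P h" if h: "h \<in> H" for h
  proof -
    have c: "x * h = h * x" for x
      using central_left_commute(1) cen[OF h] by (metis central_projection_def)
    have "P k * (h - P h) = 0" if k: "k \<in> H" for k
    proof (cases "k = h")
      case True
      with h P show ?thesis
        by (simp add: right_diff_distrib c projection_def)
    next
      case False
      have "P k * h = 0"
        using orth[OF h k] False P(2)[OF k] c by (metis mult.assoc mult_zero_left)
      moreover have "P k * P h = P k * h * P h"
        by (simp add: mult.assoc P(2)[OF h])
      ultimately show ?thesis by (simp add: right_diff_distrib)
    qed
    then have "q * (h - P h) = h - P h" using iff by blast
    moreover have "P h * q = 0" using iff[of q] qq h by blast
    then have "q * P h = 0"
      by (metis P(1)[OF h] projection_def sq star_mult star_zero)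
    ultimately have "q * h = h - P h" by (simp add: right_diff_distrib)
    then show ?thesis by (simp add: right_diff_distrib c[symmetric])
  qed
  moreover have "projection star (1 - q)"
    by (simp add: projection_def star_diff sq algebra_simps qq)
  ultimately show thesis using that by blast
qed

text \<open>
  Zorn's lemma gives a maximal orthogonal family of central projections over which \<open>x\<close> is clean. Were
  its common annihilator \<open>g\<close> nonzero, the hypothesis would provide a further member below \<open>g\<close>.
\<close>
lemma regular_plus_projection_of_clean_over:
  assumes local: "\<And>g. central_projection star g \<Longrightarrow> g \<noteq> 0 \<Longrightarrow>
      \<exists>h. central_projection star h \<and> h \<noteq> 0 \<and> g * h = h \<and> clean_over star x h"
  obtains p where "projection star p" "regular_elem (x - p)"
proof -
  define \<F> where "\<F> = {H. (\<forall>h\<in>H. central_projection star h \<and> clean_over star x h) \<and>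
      (\<forall>h\<in>H. \<forall>k\<in>H. h \<noteq> k \<longrightarrow> h * k = 0)}"
  have "\<exists>H\<in>\<F>. \<forall>K\<in>\<F>. H \<subseteq> K \<longrightarrow> K = H"
  proof (rule subset_Zorn')
    fix C assume C: "subset.chain \<F> C"
    have "h * k = 0" if hk: "h \<in> \<Union>C" "k \<in> \<Union>C" "h \<noteq> k" for h k
    proof -
      obtain A B where "A \<in> C" "B \<in> C" "h \<in> A" "k \<in> B" using hk by blast
      moreover from this C have "A \<subseteq> B \<or> B \<subseteq> A" by (auto simp: subset_chain_def)
      ultimately obtain D where "D \<in> C" "h \<in> D" "k \<in> D"
        by blast
      then show ?thesis using C hk(3) by (auto simp: \<F>_def subset_chain_def)
    qed
    then show "\<Union>C \<in> \<F>"
      using C by (fastforce simp: \<F>_def subset_chain_def)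
  qed
  then obtain H where HF: "H \<in> \<F>" and max: "\<And>K. K \<in> \<F> \<Longrightarrow> H \<subseteq> K \<Longrightarrow> K = H"
    by blast
  have H: "\<And>h. h \<in> H \<Longrightarrow> central_projection star h" "\<And>h. h \<in> H \<Longrightarrow> clean_over star x h"
    and orth: "\<And>h k. h \<in> H \<Longrightarrow> k \<in> H \<Longrightarrow> h \<noteq> k \<Longrightarrow> h * k = 0"
    using HF by (auto simp: \<F>_def)
  have Hc: "\<forall>h\<in>H. central h" using H(1) by (simp add: central_projection_def)
  obtain g where g: "central_projection star g" "\<And>z. (\<forall>h\<in>H. h * z = 0) \<longleftrightarrow> g * z = z"
    using central_projection_annihilator[OF Hc] by blast
  have "g = 0"
  proof (rule ccontr)
    assume "g \<noteq> 0"
    with local[OF g(1)] obtain h where h: "central_projection star h" "h \<noteq> 0" "g * h = h"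
      "clean_over star x h" by blast
    have kh: "k * h = 0" if "k \<in> H" for k using g(2) h(3) that by blast
    then have "h * k = 0" if "k \<in> H" for k
      using that h(1) by (simp add: central_projection_def central_def)
    with kh HF h have "insert h H \<in> \<F>" by (auto simp: \<F>_def)
    then have "h \<in> H" using max by blast
    then have "h * h = 0" by (rule kh)
    then show False using h(1,2) by (simp add: central_projection_def projection_def)
  qed
  then have zero: "z = 0" if "\<forall>h\<in>H. h * z = 0" for z
    using g(2) that by force
  obtain P V where P: "\<And>h. h \<in> H \<Longrightarrow> projection star (P h)" "\<And>h. h \<in> H \<Longrightarrow> h * P h = P h"
    and V: "\<And>h. h \<in> H \<Longrightarrow> corner_inverse h (h * x - P h) (V h)"
    using H(2) unfolding clean_over_def by metis
  obtain p where p: "projection star p" "\<And>h. h \<in> H \<Longrightarrow> h * p = P h"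
    using projection_patching[OF H(1) orth P] by blast
  have inv: "V h * (h * (x - p)) = h" "h * (x - p) * V h = h" if "h \<in> H" for h
    using V[OF that] p(2)[OF that] by (simp_all add: corner_inverse_def right_diff_distrib)
  have "z = 0" if z: "(x - p) * z = 0" for z
  proof (rule zero, intro ballI)
    fix h assume "h \<in> H"
    then have "h * z = V h * (h * ((x - p) * z))" using inv(1) by (simp add: mult.assoc[symmetric])
    then show "h * z = 0" using z by simp
  qed
  moreover have "z = 0" if z: "z * (x - p) = 0" for z
  proof (rule zero, intro ballI)
    fix h assume h: "h \<in> H"
    then have ch: "central h" using Hc by blast
    have "z * h = z * (h * (x - p)) * V h" using inv(2)[OF h] by (simp add: mult.assoc)
    also have "z * (h * (x - p)) = 0" using z by (simp add: central_left_commute[OF ch])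
    finally show "h * z = 0" by (simp add: central_left_commute(1)[OF ch])
  qed
  ultimately have "regular_elem (x - p)"
    unfolding regular_elem_def left_zero_divisor_def right_zero_divisor_def by blast
  with p(1) that show thesis by blast
qed

end

section \<open>Almost cleanness and cleanness\<close>

lemma regular_elem_invertible:
  fixes r :: "'a::{ring,monoid_mult}"
  assumes "von_neumann_regular TYPE('a)" and r: "regular_elem r"
  shows "invertible_elem r"
proof -
  obtain y where y: "r * y * r = r"
    using assms(1) unfolding von_neumann_regular_def by blast
  have "r * (y * r - 1) = 0" "(r * y - 1) * r = 0"
    using y by (simp_all add: algebra_simps)
  then have "y * r - 1 = 0" "r * y - 1 = 0"
    using r unfolding regular_elem_def left_zero_divisor_def right_zero_divisor_def by blast+
  then show ?thesis unfolding invertible_elem_def by auto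
qed

theorem theorem10:
  fixes star :: "'a::{ring,monoid_mult} \<Rightarrow> 'a" and n :: nat
  assumes "0 < n"
    and "baer_star_ring star"
    and "type_I_n star n"
    and "axiom_A2 star"
  shows "almost_star_clean star \<and> (von_neumann_regular TYPE('a) \<longrightarrow> star_clean star)"
proof -
  interpret baer_star_ring star by fact
  obtain e where e: "\<forall>i<n. abelian_projection star (e i)"
    "\<forall>i<n. \<forall>j<n. i \<noteq> j \<longrightarrow> proj_equiv star (e i) (e j) \<and> e i * e j = 0" "(\<Sum>i<n. e i) = 1"
    using assms(3) unfolding type_I_n_def by blast
  interpret homogeneous_star_ring star n e
    by unfold_locales (use e in auto)
  have EP: "axiom_EP star" using assms(4) by (simp add: axiom_A2_def)
  have dec: "\<exists>r p. regular_elem r \<and> projection star p \<and> x = r + p" for x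
  proof -
    have "\<exists>h. central_projection star h \<and> h \<noteq> 0 \<and> g * h = h \<and> clean_over star x h"
      if "central_projection star g" "g \<noteq> 0" for g
      using clean_over_some_central_projection[OF EP that] by blast
    from regular_plus_projection_of_clean_over[OF this]
    obtain p where "projection star p" "regular_elem (x - p)"
      by blast
    then show ?thesis by (intro exI[of _ "x - p"] exI[of _ p]) simp
  qed
  then have "almost_star_clean star" by (simp add: almost_star_clean_def)
  moreover have "star_clean star" if "von_neumann_regular TYPE('a)"
    using dec regular_elem_invertible[OF that] unfolding star_clean_def by metis
  ultimately show ?thesis by blast
qed

end
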